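(* Let $d\ge 2$, let $n_1,\dots,n_d$ be positive integers and let $k_i\ge 0$, $s_i\ge 0$ ($i=1,\dots,d-1$) be integers. Let $A\in\mathcal{M}_{=(k_{1},\dots,k_{d-1})}^{n_{1}\times\dots\times n_{d}}$ and let $A_{1}\in\mathbb{R}^{n_{1}\times k_{1}}$, $A_{i}\in\mathbb{R}^{k_{i-1}\times n_{i}\times k_{i}}$ ($i=2,\dots,d-1$), $A_{d}\in\mathbb{R}^{k_{d-1}\times n_{d}}$ be such that $A_{1}\cdots A_{d}=A$, $A_{1}^{T}A_{1}=I$ and $(A_{i}^{R})^{T}A_{i}^{R}=I$ for $i=2,\dots,d-1$. Let $U_1\in\mathbb{R}^{n_1\times s_1}$, $X_1\in\mathbb{R}^{n_1\times k_1}$; $U_i\in\mathbb{R}^{k_{i-1}\times n_i\times s_i}$, $X_i\in\mathbb{R}^{k_{i-1}\times n_i\times k_i}$, $Z_i\in\mathbb{R}^{s_{i-1}\times n_i\times s_i}$, $V_i\in\mathbb{R}^{s_{i-1}\times n_i\times k_i}$ ($2\le i\le d-1$); $X_d\in\mathbb{R}^{k_{d-1}\times n_d}$, $V_d\in\mathbb{R}^{s_{d-1}\times n_d}$ satisfy $(A_{i}^{R})^{T}U_{i}^{R}=0$ and $(A_{i}^{R})^{T}X_{i}^{R}=0$ for $i=1,\dots,d-1$, and $(V_{i}A_{i+1}\cdots A_{d})^{L}\left((A_{i}\cdots A_{d})^{L}\right)^{T}=0$ for $i=2,\dots,d$. Then $$\begin{pmatrix} A_{1} & U_{1} & X_{1}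 \end{pmatrix}\begin{pmatrix} A_{2} & U_{2} & X_{2} \\ 0 & Z_{2} & V_{2} \\ 0 & 0 & A_{2} \end{pmatrix}\cdots\begin{pmatrix} A_{d-1} & U_{d-1} & X_{d-1} \\ 0 & Z_{d-1} & V_{d-1} \\ 0 & 0 & A_{d-1} \end{pmatrix}\begin{pmatrix} X_{d} \\ V_{d} \\ A_{d} \end{pmatrix}$$ $$=\sum_{i=1}^{d}A_1\cdots A_{i-1}X_iA_{i+1}\cdots A_d+\sum_{1\le i<j\le d}A_1\cdots A_{i-1}\,U_i\,Z_{i+1}\cdots Z_{j-1}\,V_j\,A_{j+1}\cdots A_d,$$ and all the summands on the right-hand side are pairwise orthogonal in the standard scalar product on $\mathbb{R}^{n_1\cdots n_d}$.
   Context: Tensors are elements of $\mathbb{R}^{m_1\times\dots\times m_r}$. $B^L$ is the matricization of a tensor $B$ with the first index as row index and all others as (combined) column index; $B^R$ is the matricization with the last index as column index and all others as row index (for a matrix, $B^L=B^R=B$). $A^{(n_1\dots n_i)\times(n_{i+1}\dots n_d)}$ denotes the matricization of $A\in\mathbb{R}^{n_1\times\dots\times n_d}$ grouping the first $i$ indices as row index and the remaining ones as column index. TT product: for $A\in\mathbb{R}^{n_1\times\dots\times n_i\times k}$ and $B\in\mathbb{R}^{k\times n_{i+1}\times\dots\times n_d}$, $AB\in\mathbb{R}^{n_1\times\dots\times n_d}$ has entries $(AB)(j_1,\dots,j_d)=\sum_{m=1}^kA(j_1,\dots,j_i,m)B(m,j_{i+1},\dots,j_d)$; it is associative. A block matrix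 whose blocks are order 3 tensors denotes the order 3 tensor obtained by placing the blocks along the first index (block rows) and last index (block columns), the middle index being shared; i.e. for each fixed middle index it is the corresponding block matrix. Empty products (such as $A_1\cdots A_{i-1}$ for $i=1$ or $Z_{i+1}\cdots Z_{j-1}$ for $j=i+1$) are omitted. $\mathcal{M}_{=(k_{1},\dots,k_{d-1})}^{n_{1}\times\dots\times n_{d}}=\{A\in\mathbb{R}^{n_{1}\times\dots\times n_{d}}:\forall i:\operatorname{rank}(A^{(n_{1}\dots n_{i})\times(n_{i+1}\dots n_{d})})=k_{i}\}$. *)

theory Defs
  imports Complex_Main "Jordan_Normal_Form.DL_Rank"
begin

text \<open>Multi-indices are lists of naturals and each mode is indexed from 0. Entries outside the
  index range are 0, so that tensors are equal iff their mode sizes and entries agree.\<close>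

definition multi_indices :: "nat list \<Rightarrow> nat list set" where
  "multi_indices ns = {js. list_all2 (<) js ns}"

typedef tensor = "{(ns :: nat list, f :: nat list \<Rightarrow> real). \<forall>js. js \<notin> multi_indices ns \<longrightarrow> f js = 0}"
  by (rule exI[of _ "([], \<lambda>_. 0)"]) simp

definition dims :: "tensor \<Rightarrow> nat list" where
  "dims A = fst (Rep_tensor A)"

definition entry :: "tensor \<Rightarrow> nat list \<Rightarrow> real" (infixl "\<cdot>" 100) where
  "A \<cdot> js = snd (Rep_tensor A) js"

definition tensor :: "nat list \<Rightarrow> (nat list \<Rightarrow> real) \<Rightarrow> tensor" where
  "tensor ns f = Abs_tensor (ns, \<lambda>js. if js \<in> multi_indices ns then f js else 0)"

lemma dims_tensor [simp]: "dims (tensor ns f) = ns"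
  by (simp add: dims_def tensor_def Abs_tensor_inverse)

lemma entry_tensor: "tensor ns f \<cdot> js = (if js \<in> multi_indices ns then f js else 0)"
  by (simp add: entry_def tensor_def Abs_tensor_inverse)

lemma entry_outside: "js \<notin> multi_indices (dims A) \<Longrightarrow> A \<cdot> js = 0"
  using Rep_tensor[of A] by (auto simp: dims_def entry_def)

lemma tensor_eqI:
  assumes "dims A = dims B" and "\<And>js. js \<in> multi_indices (dims A) \<Longrightarrow> A \<cdot> js = B \<cdot> js"
  shows "A = B"
proof -
  have "A \<cdot> js = B \<cdot> js" for js
    using assms entry_outside by metis
  then have "Rep_tensor A = Rep_tensor B"
    using assms(1) by (intro prod_eqI) (auto simp: dims_def entry_def)
  then show ?thesis by (simp add: Rep_tensor_inject)
qed

definition carrier_tensor :: "nat list \<Rightarrow> tensor set" where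
  "carrier_tensor ns = {A. dims A = ns}"

definition zero_tensor :: "nat list \<Rightarrow> tensor" where
  "zero_tensor ns = tensor ns (\<lambda>_. 0)"

definition add_tensor :: "tensor \<Rightarrow> tensor \<Rightarrow> tensor" (infixl "\<oplus>\<^sub>t" 65) where
  "A \<oplus>\<^sub>t B = tensor (dims A) (\<lambda>js. A \<cdot> js + B \<cdot> js)"

definition sum_tensor :: "nat list \<Rightarrow> ('i \<Rightarrow> tensor) \<Rightarrow> 'i set \<Rightarrow> tensor" where
  "sum_tensor ns F I = tensor ns (\<lambda>js. \<Sum>i\<in>I. F i \<cdot> js)"

definition inner_tensor :: "tensor \<Rightarrow> tensor \<Rightarrow> real" where
  "inner_tensor A B = (\<Sum>js\<in>multi_indices (dims A). A \<cdot> js * B \<cdot> js)"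

text \<open>The multi-index at position \<open>r\<close> of the lexicographic enumeration of
  \<open>multi_indices ns\<close>, for \<open>r < prod_list ns\<close>.\<close>

fun nth_index :: "nat list \<Rightarrow> nat \<Rightarrow> nat list" where
  "nth_index [] r = []"
| "nth_index (n # ns) r = (r div prod_list ns) # nth_index ns (r mod prod_list ns)"

lemma multi_indices_Cons:
  "multi_indices (n # ns) = (\<lambda>(j, js). j # js) ` ({..<n} \<times> multi_indices ns)"
  by (auto simp: multi_indices_def list_all2_Cons2 image_iff)

lemma finite_multi_indices [simp]: "finite (multi_indices ns)"
  by (induction ns) (auto simp: multi_indices_Cons, simp add: multi_indices_def)

lemma card_multi_indices: "card (multi_indices ns) = prod_list ns"
proof (induction ns)
  case Nil
  then show ?case by (simp add: multi_indices_def)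
next
  case (Cons n ns)
  then show ?case
    by (simp add: multi_indices_Cons card_image inj_on_def card_cartesian_product)
qed

lemma inj_on_nth_index: "inj_on (nth_index ns) {..<prod_list ns}"
proof (induction ns)
  case Nil
  then show ?case by (simp add: inj_on_def)
next
  case (Cons n ns)
  show ?case
  proof (rule inj_onI)
    fix r s assume rs: "r \<in> {..<prod_list (n # ns)}" "s \<in> {..<prod_list (n # ns)}"
      and eq: "nth_index (n # ns) r = nth_index (n # ns) s"
    then have "prod_list ns > 0" by (auto intro: Nat.gr0I)
    with Cons eq have "r mod prod_list ns = s mod prod_list ns"
      by (auto dest: inj_onD)
    with eq show "r = s" by simp (metis div_mult_mod_eq)
  qed
qed

lemma nth_index_in: "r < prod_list ns \<Longrightarrow> nth_index ns r \<in> multi_indices ns"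
proof (induction ns arbitrary: r)
  case Nil
  then show ?case by (simp add: multi_indices_def)
next
  case (Cons n ns)
  then have "prod_list ns > 0" by (auto intro: Nat.gr0I)
  with Cons show ?case
    by (simp add: multi_indices_def less_mult_imp_div_less)
qed

lemma bij_betw_nth_index: "bij_betw (nth_index ns) {..<prod_list ns} (multi_indices ns)"
proof -
  have "nth_index ns ` {..<prod_list ns} \<subseteq> multi_indices ns"
    by (auto intro: nth_index_in)
  then have "nth_index ns ` {..<prod_list ns} = multi_indices ns"
    by (intro card_subset_eq) (simp_all add: card_image inj_on_nth_index card_multi_indices)
  then show ?thesis by (simp add: bij_betw_def inj_on_nth_index)
qed

definition matricization :: "nat \<Rightarrow> tensor \<Rightarrow> real mat" where
  "matricization i A = (let ns = take i (dims A); ms = drop i (dims A) in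
     mat (prod_list ns) (prod_list ms) (\<lambda>(r, c). A \<cdot> (nth_index ns r @ nth_index ms c)))"

definition mat_L :: "tensor \<Rightarrow> real mat" where
  "mat_L B = matricization 1 B"

definition mat_R :: "tensor \<Rightarrow> real mat" where
  "mat_R B = matricization (length (dims B) - 1) B"

lemma mat_of_matrix:
  assumes "dims B = [m, n]"
  shows "mat_L B = mat m n (\<lambda>(r, c). B \<cdot> [r, c])" "mat_R B = mat m n (\<lambda>(r, c). B \<cdot> [r, c])"
  using assms by (auto simp: mat_L_def mat_R_def matricization_def intro!: eq_matI)

definition TT_rank_manifold :: "nat list \<Rightarrow> (nat \<Rightarrow> nat) \<Rightarrow> tensor set" where
  "TT_rank_manifold ns k = {A \<in> carrier_tensor ns. \<forall>i\<in>{1..<length ns}.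
     vec_space.rank (dim_row (matricization i A)) (matricization i A) = k i}"

definition foldr_nonempty :: "('a \<Rightarrow> 'a \<Rightarrow> 'a) \<Rightarrow> 'a list \<Rightarrow> 'a" where
  "foldr_nonempty f xs = foldr f (butlast xs) (last xs)"

lemma foldr_nonempty_simps [simp]:
  "foldr_nonempty f [x] = x"
  "foldr_nonempty f (x # y # xs) = f x (foldr_nonempty f (y # xs))"
  by (simp_all add: foldr_nonempty_def)

text \<open>Meaningful only for \<open>last (dims A) = hd (dims B)\<close>.\<close>

definition tt_mult :: "tensor \<Rightarrow> tensor \<Rightarrow> tensor" where
  "tt_mult A B = tensor (butlast (dims A) @ tl (dims B))
     (\<lambda>js. let i = length (dims A) - 1 in
        \<Sum>m<last (dims A). A \<cdot> (take i js @ [m]) * B \<cdot> (m # drop i js))"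

definition tt_prod :: "tensor list \<Rightarrow> tensor" where
  "tt_prod = foldr_nonempty tt_mult"

definition append_last :: "tensor \<Rightarrow> tensor \<Rightarrow> tensor" where
  "append_last A B = tensor (butlast (dims A) @ [last (dims A) + last (dims B)])
     (\<lambda>js. if last js < last (dims A) then A \<cdot> js
           else B \<cdot> (butlast js @ [last js - last (dims A)]))"

definition append_first :: "tensor \<Rightarrow> tensor \<Rightarrow> tensor" where
  "append_first A B = tensor ((hd (dims A) + hd (dims B)) # tl (dims A))
     (\<lambda>js. if hd js < hd (dims A) then A \<cdot> js
           else B \<cdot> ((hd js - hd (dims A)) # tl js))"

text \<open>The argument is the list of block rows. For tensors of order 2 this is the usual
  block matrix.\<close>

definition block_tensor :: "tensor list list \<Rightarrow> tensor" where
  "block_tensor Ass = foldr_nonempty append_first (map (foldr_nonempty append_last) Ass)"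

end

(* The block cores form an upper triangular automaton with three states: A, Z, A on the diagonal,
   U, V, X on the transitions. Multiplying the block cores onto the last block column from right
   to left keeps a block column of the form (singles + doubles, chains Z...Z V A...A, A...A).

   Orthogonality: the inner product of two products G B and H B' is the entrywise pairing of the
   Gram matrix of G^R, H^R with the one of B^L, B'^L. The common left factors A_i are orthonormal
   and peel off; then either the next two cores are A_i and one of U_i, X_i, with zero right Gram
   matrix, or both are among U_i, X_i, and the remaining right factors have zero left Gram matrix:
   this property starts at the core V_j of the shorter chain, by the hypothesis on V_j, and is
   preserved by adding further cores on the left. *)

theory Submission
  imports Defs
begin

section \<open>Multi-indices\<close>

lemma multi_indices_Nil [simp]: "multi_indices [] = {[]}"
  by (auto simp: multi_indices_def)

lemma multi_indices_append:
  "multi_indices (ps @ qs) = (\<lambda>(is, js). is @ js) ` (multi_indices ps \<times> multi_indices qs)"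
  by (auto simp: multi_indices_def list_all2_append2 image_iff intro: list_all2_appendI)
    (metis list_all2_lengthD)

lemma length_multi_indices: "js \<in> multi_indices ns \<Longrightarrow> length js = length ns"
  by (auto simp: multi_indices_def dest: list_all2_lengthD)

lemma append_in_multi_indices:
  "is \<in> multi_indices ps \<Longrightarrow> js \<in> multi_indices qs \<Longrightarrow> is @ js \<in> multi_indices (ps @ qs)"
  by (auto simp: multi_indices_append)

lemma Cons_in_multi_indices_iff [simp]:
  "m # js \<in> multi_indices (b # qs) \<longleftrightarrow> m < b \<and> js \<in> multi_indices qs"
  by (auto simp: multi_indices_Cons)

lemma snoc_in_multi_indices:
  "is \<in> multi_indices ps \<Longrightarrow> m < b \<Longrightarrow> is @ [m] \<in> multi_indices (ps @ [b])"
  by (rule append_in_multi_indices) auto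

text \<open>All prefixes have the same length, so concatenation is injective and the sum splits at
  the boundary between two cores.\<close>

lemma sum_multi_indices_append:
  "(\<Sum>js\<in>multi_indices (ps @ qs). f js) =
   (\<Sum>is\<in>multi_indices ps. \<Sum>js\<in>multi_indices qs. f (is @ js))"
proof -
  have "inj_on (\<lambda>(is, js). is @ js) (multi_indices ps \<times> multi_indices qs)"
    by (auto simp: inj_on_def dest!: length_multi_indices)
  then show ?thesis
    by (simp add: multi_indices_append sum.reindex sum.cartesian_product case_prod_unfold)
qed

lemma sum_multi_indices_Cons:
  "(\<Sum>js\<in>multi_indices (b # qs). f js) = (\<Sum>m<b. \<Sum>js\<in>multi_indices qs. f (m # js))"
proof -
  have "inj_on (\<lambda>(j, js). j # js) ({..<b} \<times> multi_indices qs)"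
    by (auto simp: inj_on_def)
  then show ?thesis
    by (simp add: multi_indices_Cons sum.reindex sum.cartesian_product case_prod_unfold)
qed

text \<open>Lexicographic enumeration is a bijection; this turns the flattened summation index of a
  matrix product into a multi-index.\<close>

lemma sum_nth_index: "(\<Sum>r<prod_list ns. f (nth_index ns r)) = (\<Sum>js\<in>multi_indices ns. f js)"
  using bij_betw_nth_index by (rule sum.reindex_bij_betw)

lemma sum_lessThan_add:
  fixes f :: "nat \<Rightarrow> 'a::comm_monoid_add"
  shows "(\<Sum>m<a + b. f m) = (\<Sum>m<a. f m) + (\<Sum>m<b. f (a + m))"
  by (induction b) (simp_all add: add.assoc)

section \<open>Linear structure\<close>

lemma tensor_eqI': "dims A = dims B \<Longrightarrow> (\<And>js. A \<cdot> js = B \<cdot> js) \<Longrightarrow> A = B"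
  by (rule tensor_eqI)

lemma dims_zero_tensor [simp]: "dims (zero_tensor ns) = ns"
  by (simp add: zero_tensor_def)

lemma entry_zero_tensor [simp]: "zero_tensor ns \<cdot> js = 0"
  by (simp add: zero_tensor_def entry_tensor)

lemma dims_add_tensor [simp]: "dims (A \<oplus>\<^sub>t B) = dims A"
  by (simp add: add_tensor_def)

text \<open>Outside the common index range both sides vanish, so the formula holds at every list and
  \<open>tensor_eqI'\<close> can be used with it.\<close>

lemma entry_add_tensor: "dims A = dims B \<Longrightarrow> (A \<oplus>\<^sub>t B) \<cdot> js = A \<cdot> js + B \<cdot> js"
  using entry_outside[of js A] entry_outside[of js B] by (auto simp: add_tensor_def entry_tensor)

lemma dims_sum_tensor [simp]: "dims (sum_tensor ns F I) = ns"
  by (simp add: sum_tensor_def)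

lemma entry_sum_tensor:
  "(\<And>i. i \<in> I \<Longrightarrow> dims (F i) = ns) \<Longrightarrow> sum_tensor ns F I \<cdot> js = (\<Sum>i\<in>I. F i \<cdot> js)"
  using entry_outside[of js] by (auto simp: sum_tensor_def entry_tensor intro!: sum.neutral[symmetric])

section \<open>Tensor train products\<close>

lemma dims_tt_mult: "dims A = ps @ [b] \<Longrightarrow> dims B = c # qs \<Longrightarrow> dims (tt_mult A B) = ps @ qs"
  by (simp add: tt_mult_def)

text \<open>With the multi-index already split as \<open>is @ js\<close>, the \<open>take\<close>
  and \<open>drop\<close> of the definition return the two parts.\<close>

lemma entry_tt_mult:
  assumes "dims A = ps @ [b]" "dims B = b # qs" "is \<in> multi_indices ps" "js \<in> multi_indices qs"
  shows "tt_mult A B \<cdot> (is @ js) = (\<Sum>m<b. A \<cdot> (is @ [m]) * B \<cdot> (m # js))"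
  using assms append_in_multi_indices[OF assms(3,4)]
  by (simp add: tt_mult_def entry_tensor length_multi_indices)

lemma tt_mult_eqI:
  assumes "dims A = ps @ [b]" "dims B = b # qs" "dims C = ps @ qs"
    and "\<And>is js. is \<in> multi_indices ps \<Longrightarrow> js \<in> multi_indices qs \<Longrightarrow>
      (\<Sum>m<b. A \<cdot> (is @ [m]) * B \<cdot> (m # js)) = C \<cdot> (is @ js)"
  shows "tt_mult A B = C"
proof (rule tensor_eqI)
  show "dims (tt_mult A B) = dims C" using assms by (simp add: dims_tt_mult)
  fix js assume "js \<in> multi_indices (dims (tt_mult A B))"
  then have "js \<in> multi_indices (ps @ qs)" using assms by (simp add: dims_tt_mult)
  then show "tt_mult A B \<cdot> js = C \<cdot> js"
    using assms by (auto simp: multi_indices_append entry_tt_mult)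
qed

lemma tt_mult_add_right:
  assumes "dims A = ps @ [b]" "dims B = b # qs" "dims C = b # qs"
  shows "tt_mult A (B \<oplus>\<^sub>t C) = tt_mult A B \<oplus>\<^sub>t tt_mult A C"
  by (rule tt_mult_eqI[where ps = ps and b = b and qs = qs])
    (use assms in \<open>simp_all add: dims_tt_mult entry_add_tensor entry_tt_mult distrib_left
      sum.distrib\<close>)

text \<open>Distributes a core over the sums of shorter products, which arise when multiplying from
  right to left.\<close>

lemma tt_mult_sum_right:
  assumes "dims A = ps @ [b]" "\<And>i. i \<in> I \<Longrightarrow> dims (F i) = b # qs"
  shows "tt_mult A (sum_tensor (b # qs) F I) = sum_tensor (ps @ qs) (\<lambda>i. tt_mult A (F i)) I"
proof (rule tt_mult_eqI[where ps = ps and b = b and qs = qs])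
  fix "is" js assume js: "is \<in> multi_indices ps" "js \<in> multi_indices qs"
  have "(\<Sum>m<b. A \<cdot> (is @ [m]) * sum_tensor (b # qs) F I \<cdot> (m # js)) =
      (\<Sum>m<b. \<Sum>i\<in>I. A \<cdot> (is @ [m]) * F i \<cdot> (m # js))"
    using assms by (simp add: entry_sum_tensor sum_distrib_left)
  also have "\<dots> = (\<Sum>i\<in>I. tt_mult A (F i) \<cdot> (is @ js))"
    using assms js by (subst sum.swap) (simp add: entry_tt_mult)
  also have "\<dots> = sum_tensor (ps @ qs) (\<lambda>i. tt_mult A (F i)) I \<cdot> (is @ js)"
    using assms by (subst entry_sum_tensor) (auto simp: dims_tt_mult)
  finally show "(\<Sum>m<b. A \<cdot> (is @ [m]) * sum_tensor (b # qs) F I \<cdot> (m # js)) =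
      sum_tensor (ps @ qs) (\<lambda>i. tt_mult A (F i)) I \<cdot> (is @ js)" .
qed (use assms in simp_all)

lemma tt_mult_zero_left:
  assumes "dims B = b # qs"
  shows "tt_mult (zero_tensor (ps @ [b])) B = zero_tensor (ps @ qs)"
  by (rule tt_mult_eqI[where ps = ps and b = b and qs = qs]) (use assms in simp_all)

lemma tt_prod_single [simp]: "tt_prod [G] = G"
  by (simp add: tt_prod_def)

lemma tt_prod_Cons: "Gs \<noteq> [] \<Longrightarrow> tt_prod (G # Gs) = tt_mult G (tt_prod Gs)"
  by (cases Gs) (simp_all add: tt_prod_def)

section \<open>Block tensors\<close>

lemma dims_append_last [simp]:
  "dims A = ps @ [a] \<Longrightarrow> dims B = qs @ [b] \<Longrightarrow> dims (append_last A B) = ps @ [a + b]"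
  by (simp add: append_last_def)

lemma dims_append_first [simp]:
  "dims A = a # ps \<Longrightarrow> dims B = b # qs \<Longrightarrow> dims (append_first A B) = (a + b) # ps"
  by (simp add: append_first_def)

lemma entry_append_last:
  assumes "dims A = ps @ [a]" "dims B = ps @ [b]" "is \<in> multi_indices ps"
  shows "m < a \<Longrightarrow> append_last A B \<cdot> (is @ [m]) = A \<cdot> (is @ [m])"
    and "m < b \<Longrightarrow> append_last A B \<cdot> (is @ [a + m]) = B \<cdot> (is @ [m])"
  using assms snoc_in_multi_indices[OF assms(3), of m "a + b"]
    snoc_in_multi_indices[OF assms(3), of "a + m" "a + b"]
  by (simp_all add: append_last_def entry_tensor)

lemma entry_append_first:
  assumes "dims A = a # qs" "dims B = b # qs" "js \<in> multi_indices qs"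
  shows "m < a \<Longrightarrow> append_first A B \<cdot> (m # js) = A \<cdot> (m # js)"
    and "m < b \<Longrightarrow> append_first A B \<cdot> ((a + m) # js) = B \<cdot> (m # js)"
  using assms by (simp_all add: append_first_def entry_tensor)

text \<open>The contracted index runs over \<open>a + b\<close> values; splitting the sum at
  \<open>a\<close> gives the usual product of a block row and a block column.\<close>

lemma tt_mult_append_last_append_first:
  assumes "dims A = ps @ [a]" "dims B = ps @ [b]" "dims C = a # qs" "dims D = b # qs"
  shows "tt_mult (append_last A B) (append_first C D) = tt_mult A C \<oplus>\<^sub>t tt_mult B D"
  by (rule tt_mult_eqI[where ps = ps and b = "a + b" and qs = qs])
    (use assms in \<open>simp_all add: dims_tt_mult entry_add_tensor entry_tt_mult sum_lessThan_add
      entry_append_last[OF assms(1,2)] entry_append_first[OF assms(3,4)]\<close>)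

text \<open>The first index of the left factor is not contracted, so stacking along it commutes with
  multiplication on the right.\<close>

lemma tt_mult_append_first_left:
  assumes "dims A = a # ps @ [c]" "dims B = b # ps @ [c]" "dims C = c # qs"
  shows "tt_mult (append_first A B) C = append_first (tt_mult A C) (tt_mult B C)"
proof (rule tt_mult_eqI[where ps = "(a + b) # ps" and b = c and qs = qs])
  have AC: "dims (tt_mult A C) = a # ps @ qs" and BC: "dims (tt_mult B C) = b # ps @ qs"
    using assms dims_tt_mult[of _ "_ # ps"] by simp_all
  then show "dims (append_first (tt_mult A C) (tt_mult B C)) = ((a + b) # ps) @ qs" by simp
  fix "is" js assume "is \<in> multi_indices ((a + b) # ps)" and js: "js \<in> multi_indices qs"
  then obtain m is' where is': "is = m # is'" "m < a + b" "is' \<in> multi_indices ps"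
    by (auto simp: multi_indices_Cons)
  note cat = append_in_multi_indices[OF is'(3) js]
  note snoc = snoc_in_multi_indices[OF is'(3), of _ c]
  show "(\<Sum>l<c. append_first A B \<cdot> (is @ [l]) * C \<cdot> (l # js)) =
      append_first (tt_mult A C) (tt_mult B C) \<cdot> (is @ js)"
  \<comment> \<open>The row index \<open>m\<close> lies either in the upper block \<open>A\<close>
    or, shifted by \<open>a\<close>, in the lower block \<open>B\<close>.\<close>
  proof (cases "m < a")
    case True
    then show ?thesis
      using is' js cat snoc entry_tt_mult[of A "a # ps" c C qs "m # is'" js] assms
      by (simp add: entry_append_first[OF AC BC] entry_append_first[OF assms(1,2)])
  next
    case False
    then obtain m' where m': "m = a + m'" "m' < b"
      using is' by (metis add_less_cancel_left le_add_diff_inverse not_less)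
    then show ?thesis
      using is' js cat snoc entry_tt_mult[of B "b # ps" c C qs "m' # is'" js] assms
      by (simp add: entry_append_first[OF AC BC] entry_append_first[OF assms(1,2)])
  qed
qed (use assms in simp_all)

lemma block_row: "block_tensor [[A, B, C]] = append_last A (append_last B C)"
  by (simp add: block_tensor_def)

lemma block_column: "block_tensor [[A], [B], [C]] = append_first A (append_first B C)"
  by (simp add: block_tensor_def)

lemma tt_mult_block_row_column:
  assumes "dims A = ps @ [a]" "dims B = ps @ [b]" "dims C = ps @ [c]"
    and "dims A' = a # qs" "dims B' = b # qs" "dims C' = c # qs"
  shows "tt_mult (block_tensor [[A, B, C]]) (block_tensor [[A'], [B'], [C']]) =
    tt_mult A A' \<oplus>\<^sub>t (tt_mult B B' \<oplus>\<^sub>t tt_mult C C')"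
proof -
  have "dims (append_last B C) = ps @ [b + c]" "dims (append_first B' C') = (b + c) # qs"
    using assms by simp_all
  then show ?thesis
    using assms by (simp add: block_row block_column
      tt_mult_append_last_append_first[where ps = ps and qs = qs])
qed

text \<open>Reduces the product with a 3 by 3 block core to three products of the form treated in
  \<open>tt_mult_block_row_column\<close>.\<close>

lemma tt_mult_block_rows:
  assumes "dims A1 = a # ps @ [l]" "dims B1 = a # ps @ [m]" "dims C1 = a # ps @ [r]"
    and "dims A2 = b # ps @ [l]" "dims B2 = b # ps @ [m]" "dims C2 = b # ps @ [r]"
    and "dims A3 = c # ps @ [l]" "dims B3 = c # ps @ [m]" "dims C3 = c # ps @ [r]"
    and "dims H = (l + (m + r)) # qs"
  shows "tt_mult (block_tensor [[A1, B1, C1], [A2, B2, C2], [A3, B3, C3]]) H =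
    block_tensor [[tt_mult (block_tensor [[A1, B1, C1]]) H],
      [tt_mult (block_tensor [[A2, B2, C2]]) H], [tt_mult (block_tensor [[A3, B3, C3]]) H]]"
proof -
  let ?R = "\<lambda>A B C. append_last A (append_last B C)"
  have R: "dims (?R A1 B1 C1) = a # ps @ [l + (m + r)]" "dims (?R A2 B2 C2) = b # ps @ [l + (m + r)]"
    "dims (?R A3 B3 C3) = c # ps @ [l + (m + r)]"
    using assms dims_append_last[of _ "_ # ps"] by simp_all
  then have "dims (append_first (?R A2 B2 C2) (?R A3 B3 C3)) = (b + c) # ps @ [l + (m + r)]"
    by simp
  with R assms(10) show ?thesis
    by (simp add: block_tensor_def tt_mult_append_first_left[where ps = ps])
qed

section \<open>Gram matrices\<close>

text \<open>For matching trailing modes this is the \<open>(m, l)\<close> entry of the product of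
  the left matricization of \<open>B\<close> with the transposed one of \<open>C\<close>. Summing
  over multi-indices instead of flattened columns allows splitting at core boundaries;
  \<open>gram_R\<close> is the mirror image.\<close>

definition gram_L :: "tensor \<Rightarrow> tensor \<Rightarrow> nat \<Rightarrow> nat \<Rightarrow> real" where
  "gram_L B C m l = (\<Sum>js\<in>multi_indices (tl (dims B)). B \<cdot> (m # js) * C \<cdot> (l # js))"

definition gram_R :: "tensor \<Rightarrow> tensor \<Rightarrow> nat \<Rightarrow> nat \<Rightarrow> real" where
  "gram_R A C m l = (\<Sum>js\<in>multi_indices (butlast (dims A)). A \<cdot> (js @ [m]) * C \<cdot> (js @ [l]))"

lemma mat_L_mult_transpose_entry:
  assumes "dims B = b # qs" "dims C = c # qs" "m < b" "l < c"
  shows "(mat_L B * transpose_mat (mat_L C)) $$ (m, l) = gram_L B C m l"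
proof -
  have "(mat_L B * transpose_mat (mat_L C)) $$ (m, l) =
      (\<Sum>r<prod_list qs. B \<cdot> (m # nth_index qs r) * C \<cdot> (l # nth_index qs r))"
    using assms by (simp add: mat_L_def matricization_def scalar_prod_def lessThan_atLeast0)
  then show ?thesis
    using assms sum_nth_index[of "\<lambda>js. B \<cdot> (m # js) * C \<cdot> (l # js)" qs] by (simp add: gram_L_def)
qed

lemma transpose_mat_R_mult_entry:
  assumes "dims A = ps @ [a]" "dims C = ps @ [c]" "m < a" "l < c"
  shows "(transpose_mat (mat_R A) * mat_R C) $$ (m, l) = gram_R A C m l"
proof -
  have "(transpose_mat (mat_R A) * mat_R C) $$ (m, l) =
      (\<Sum>r<prod_list ps. A \<cdot> (nth_index ps r @ [m]) * C \<cdot> (nth_index ps r @ [l]))"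
    using assms by (simp add: mat_R_def matricization_def scalar_prod_def lessThan_atLeast0)
  then show ?thesis
    using assms sum_nth_index[of "\<lambda>js. A \<cdot> (js @ [m]) * C \<cdot> (js @ [l])" ps] by (simp add: gram_R_def)
qed

lemma inner_tensor_commute: "dims A = dims B \<Longrightarrow> inner_tensor A B = inner_tensor B A"
  by (simp add: inner_tensor_def mult.commute)

lemma gram_L_commute: "dims B = b # qs \<Longrightarrow> dims C = c # qs \<Longrightarrow> gram_L B C m l = gram_L C B l m"
  by (simp add: gram_L_def mult.commute)

lemma gram_R_commute: "dims A = ps @ [a] \<Longrightarrow> dims C = ps @ [c] \<Longrightarrow> gram_R A C m l = gram_R C A l m"
  by (simp add: gram_R_def mult.commute)

text \<open>Expanding both products and moving the sum over the shared modes \<open>qs\<close>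
  inside produces \<open>gram_L B B'\<close>. The prefixes may differ: inner products use equal
  ones, while left Gram matrices use prefixes with different first indices.\<close>

lemma sum_tt_mult_products:
  assumes "dims A = ps @ [a]" "dims B = a # qs" "dims A' = ps' @ [a']" "dims B' = a' # qs"
    and "is \<in> multi_indices ps" "is' \<in> multi_indices ps'"
  shows "(\<Sum>js\<in>multi_indices qs. tt_mult A B \<cdot> (is @ js) * tt_mult A' B' \<cdot> (is' @ js)) =
    (\<Sum>m<a. \<Sum>l<a'. A \<cdot> (is @ [m]) * A' \<cdot> (is' @ [l]) * gram_L B B' m l)"
proof -
  have "(\<Sum>js\<in>multi_indices qs. tt_mult A B \<cdot> (is @ js) * tt_mult A' B' \<cdot> (is' @ js)) =
      (\<Sum>js\<in>multi_indices qs. \<Sum>m<a. \<Sum>l<a'.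
        A \<cdot> (is @ [m]) * A' \<cdot> (is' @ [l]) * (B \<cdot> (m # js) * B' \<cdot> (l # js)))"
    using assms by (intro sum.cong refl) (simp add: entry_tt_mult sum_product mult_ac)
  also have "\<dots> = (\<Sum>m<a. \<Sum>l<a'. \<Sum>js\<in>multi_indices qs.
        A \<cdot> (is @ [m]) * A' \<cdot> (is' @ [l]) * (B \<cdot> (m # js) * B' \<cdot> (l # js)))"
    by (subst sum.swap, rule sum.cong[OF refl], subst sum.swap, rule refl)
  finally show ?thesis
    using assms by (simp add: gram_L_def sum_distrib_left)
qed

lemma inner_tt_mult:
  assumes "dims A = ps @ [a]" "dims B = a # qs" "dims A' = ps @ [a']" "dims B' = a' # qs"
  shows "inner_tensor (tt_mult A B) (tt_mult A' B') =
    (\<Sum>m<a. \<Sum>l<a'. gram_R A A' m l * gram_L B B' m l)"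
proof -
  have "inner_tensor (tt_mult A B) (tt_mult A' B') = (\<Sum>is\<in>multi_indices ps. \<Sum>m<a. \<Sum>l<a'.
      A \<cdot> (is @ [m]) * A' \<cdot> (is @ [l]) * gram_L B B' m l)"
    using assms by (simp add: inner_tensor_def dims_tt_mult sum_multi_indices_append
      sum_tt_mult_products[where ps = ps and ps' = ps])
  also have "\<dots> = (\<Sum>m<a. \<Sum>l<a'. \<Sum>is\<in>multi_indices ps.
      A \<cdot> (is @ [m]) * A' \<cdot> (is @ [l]) * gram_L B B' m l)"
    by (subst sum.swap, rule sum.cong[OF refl], subst sum.swap, rule refl)
  finally show ?thesis
    using assms by (simp add: gram_R_def sum_distrib_right)
qed

section \<open>Vanishing Gram matrices and their effect on products\<close>

definition orth_L :: "tensor \<Rightarrow> tensor \<Rightarrow> bool" where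
  "orth_L B C \<longleftrightarrow> (\<forall>m<hd (dims B). \<forall>l<hd (dims C). gram_L B C m l = 0)"

definition orth_R :: "tensor \<Rightarrow> tensor \<Rightarrow> bool" where
  "orth_R A C \<longleftrightarrow> (\<forall>m<last (dims A). \<forall>l<last (dims C). gram_R A C m l = 0)"

lemma orth_L_commute: "dims B = b # qs \<Longrightarrow> dims C = c # qs \<Longrightarrow> orth_L B C \<Longrightarrow> orth_L C B"
  by (auto simp: orth_L_def gram_L_commute[of C c qs B b])

lemma orth_R_commute: "dims A = ps @ [a] \<Longrightarrow> dims C = ps @ [c] \<Longrightarrow> orth_R A C \<Longrightarrow> orth_R C A"
  by (auto simp: orth_R_def gram_R_commute[of C ps c A a])

text \<open>Every entry of the new left Gram matrix is a linear combination of entries of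
  \<open>gram_L B B'\<close>, whatever the left factors \<open>A\<close> and \<open>A'\<close>
  are.\<close>

lemma orth_L_tt_mult:
  assumes "dims A = b # ps @ [a]" "dims B = a # qs" "dims A' = b' # ps @ [a']" "dims B' = a' # qs"
    and "orth_L B B'"
  shows "orth_L (tt_mult A B) (tt_mult A' B')"
proof -
  have dims: "dims (tt_mult A B) = b # ps @ qs" "dims (tt_mult A' B') = b' # ps @ qs"
    using assms dims_tt_mult[of _ "_ # ps"] by simp_all
  have "gram_L (tt_mult A B) (tt_mult A' B') m l = 0" if "m < b" "l < b'" for m l
  proof -
    have "(\<Sum>js\<in>multi_indices qs. tt_mult A B \<cdot> (m # is @ js) * tt_mult A' B' \<cdot> (l # is @ js)) = 0"
      if "is \<in> multi_indices ps" for "is"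
      using sum_tt_mult_products[of A "b # ps" a B qs A' "b' # ps" a' B' "m # is" "l # is"]
        assms that \<open>m < b\<close> \<open>l < b'\<close> by (simp add: orth_L_def)
    then show ?thesis by (simp add: gram_L_def dims sum_multi_indices_append)
  qed
  then show ?thesis by (simp add: orth_L_def dims)
qed

text \<open>Each term of \<open>inner_tt_mult\<close> is a product of a right and a left Gram entry,
  so it suffices that one of the two matrices vanishes.\<close>

lemma inner_tt_mult_orth:
  assumes "dims A = ps @ [a]" "dims B = a # qs" "dims A' = ps @ [a']" "dims B' = a' # qs"
    and "orth_R A A' \<or> orth_L B B'"
  shows "inner_tensor (tt_mult A B) (tt_mult A' B') = 0"
  using assms by (auto simp: inner_tt_mult orth_R_def orth_L_def)

text \<open>The identity Gram matrix collapses the double sum to the trace of the left Gram matrix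
  of \<open>B\<close> and \<open>B'\<close>, which is their inner product.\<close>

lemma inner_tt_mult_orthonormal:
  assumes "dims A = ps @ [a]" "dims B = a # qs" "dims B' = a # qs"
    and "\<And>m l. m < a \<Longrightarrow> l < a \<Longrightarrow> gram_R A A m l = (if m = l then 1 else 0)"
  shows "inner_tensor (tt_mult A B) (tt_mult A B') = inner_tensor B B'"
proof -
  have "inner_tensor (tt_mult A B) (tt_mult A B') =
      (\<Sum>m<a. \<Sum>l<a. if m = l then gram_L B B' m l else 0)"
    using assms by (simp only: inner_tt_mult) (intro sum.cong refl, simp)
  also have "\<dots> = (\<Sum>m<a. gram_L B B' m m)"
    by simp
  finally show ?thesis
    using assms by (simp add: inner_tensor_def gram_L_def sum_multi_indices_Cons)
qed

section \<open>Cores of a tensor train and its corrections\<close>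

text \<open>The first core is a matrix; treating its missing first mode as an empty prefix makes it
  uniform with the others.\<close>

definition lead :: "(nat \<Rightarrow> nat) \<Rightarrow> nat \<Rightarrow> nat list" where
  "lead r i = (if i = 1 then [] else [r (i - 1)])"

lemma lead_Suc [simp]: "1 \<le> i \<Longrightarrow> lead r (Suc i) = [r i]"
  by (simp add: lead_def)

text \<open>Fixes the shapes of the cores for the block product identity;
  \<open>orthogonal_tt_cores\<close> adds the relations behind the inner products.\<close>

locale tt_cores =
  fixes d :: nat and n k s :: "nat \<Rightarrow> nat" and A U X Z V :: "nat \<Rightarrow> tensor"
  assumes dims_A: "1 \<le> i \<Longrightarrow> i < d \<Longrightarrow> dims (A i) = lead k i @ [n i, k i]"
    and dims_A_last: "dims (A d) = [k (d - 1), n d]"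
    and dims_U: "1 \<le> i \<Longrightarrow> i < d \<Longrightarrow> dims (U i) = lead k i @ [n i, s i]"
    and dims_X: "1 \<le> i \<Longrightarrow> i < d \<Longrightarrow> dims (X i) = lead k i @ [n i, k i]"
    and dims_X_last: "dims (X d) = [k (d - 1), n d]"
    and dims_Z: "2 \<le> i \<Longrightarrow> i < d \<Longrightarrow> dims (Z i) = [s (i - 1), n i, s i]"
    and dims_V: "2 \<le> i \<Longrightarrow> i < d \<Longrightarrow> dims (V i) = [s (i - 1), n i, k i]"
    and dims_V_last: "dims (V d) = [s (d - 1), n d]"
    and d_ge_2: "2 \<le> d"
begin

section \<open>Partial products of the cores from position i to d\<close>

abbreviation modes :: "nat \<Rightarrow> nat list" where
  "modes i \<equiv> map n [i..<Suc d]"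

text \<open>The following products are truncated to the cores \<open>i\<close> to \<open>d\<close>,
  so that induction can run from right to left. At \<open>i = 1\<close>, \<open>single\<close> and
  \<open>double\<close> are the summands of the theorem; \<open>chain (Suc p) q\<close> is the part
  of a double term to the right of \<open>U p\<close>.\<close>

definition tail :: "nat \<Rightarrow> tensor" where
  "tail i = tt_prod (map A [i..<Suc d])"

definition single :: "nat \<Rightarrow> nat \<Rightarrow> tensor" where
  "single i l = tt_prod (map A [i..<l] @ [X l] @ map A [Suc l..<Suc d])"

definition chain :: "nat \<Rightarrow> nat \<Rightarrow> tensor" where
  "chain i q = tt_prod (map Z [i..<q] @ [V q] @ map A [Suc q..<Suc d])"

definition double :: "nat \<Rightarrow> nat \<times> nat \<Rightarrow> tensor" where
  "double i = (\<lambda>(p, q). tt_prod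
    (map A [i..<p] @ [U p] @ map Z [Suc p..<q] @ [V q] @ map A [Suc q..<Suc d]))"

definition pairs :: "nat \<Rightarrow> (nat \<times> nat) set" where
  "pairs i = {(p, q). i \<le> p \<and> p < q \<and> q \<le> d}"

lemma modes_step: "i \<le> d \<Longrightarrow> modes i = n i # modes (Suc i)"
  by (simp add: upt_conv_Cons del: upt_Suc)

lemma tail_step: "i < d \<Longrightarrow> tail i = tt_mult (A i) (tail (Suc i))"
  by (simp add: tail_def upt_conv_Cons tt_prod_Cons del: upt_Suc)

lemma tail_last [simp]: "tail d = A d"
  by (simp add: tail_def)

lemma single_step: "i < l \<Longrightarrow> single i l = tt_mult (A i) (single (Suc i) l)"
  by (simp add: single_def upt_conv_Cons[of i l] tt_prod_Cons del: upt_Suc)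

lemma single_start: "i < d \<Longrightarrow> single i i = tt_mult (X i) (tail (Suc i))"
  by (simp add: single_def tail_def tt_prod_Cons del: upt_Suc)

lemma single_last [simp]: "single d d = X d"
  by (simp add: single_def)

lemma chain_step: "i < q \<Longrightarrow> chain i q = tt_mult (Z i) (chain (Suc i) q)"
  by (simp add: chain_def upt_conv_Cons[of i q] tt_prod_Cons del: upt_Suc)

lemma chain_start: "i < d \<Longrightarrow> chain i i = tt_mult (V i) (tail (Suc i))"
  by (simp add: chain_def tail_def tt_prod_Cons del: upt_Suc)

lemma chain_last [simp]: "chain d d = V d"
  by (simp add: chain_def)

lemma double_step: "i < p \<Longrightarrow> double i (p, q) = tt_mult (A i) (double (Suc i) (p, q))"
  by (simp add: double_def upt_conv_Cons[of i p] tt_prod_Cons del: upt_Suc)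

lemma double_start: "double i (i, q) = tt_mult (U i) (chain (Suc i) q)"
  by (simp add: double_def chain_def tt_prod_Cons del: upt_Suc)

lemma dims_tail:
  assumes "1 \<le> i" "i \<le> d"
  shows "dims (tail i) = lead k i @ modes i"
  using assms(2,1)
proof (induction i rule: inc_induct)
  case base
  then show ?case using d_ge_2 by (simp add: dims_A_last lead_def)
next
  case (step i)
  then have "dims (tail (Suc i)) = k i # modes (Suc i)" by simp
  with step show ?case
    using dims_tt_mult[of "A i" "lead k i @ [n i]"] by (simp add: tail_step dims_A modes_step del: upt_Suc)
qed

lemma dims_tail_Suc: "1 \<le> i \<Longrightarrow> i < d \<Longrightarrow> dims (tail (Suc i)) = k i # modes (Suc i)"
  by (simp add: dims_tail del: upt_Suc)

lemma dims_single:
  assumes "1 \<le> i" "i \<le> l" "l \<le> d"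
  shows "dims (single i l) = lead k i @ modes i"
  using assms(2,1)
proof (induction i rule: inc_induct)
  case base
  show ?case
  \<comment> \<open>\<open>X d\<close> is a matrix that ends the product, whereas an earlier
    \<open>X l\<close> is followed by a tail.\<close>
  proof (cases "l = d")
    case True
    then show ?thesis using d_ge_2 by (simp add: dims_X_last lead_def)
  next
    case False
    with base assms show ?thesis
      using dims_tt_mult[of "X l" "lead k l @ [n l]"]
      by (simp add: single_start dims_X dims_tail_Suc modes_step del: upt_Suc)
  qed
next
  case (step i)
  then have "dims (single (Suc i) l) = k i # modes (Suc i)" by simp
  with step assms(3) show ?case
    using dims_tt_mult[of "A i" "lead k i @ [n i]"]
    by (simp add: single_step dims_A modes_step del: upt_Suc)
qed

lemma dims_chain:
  assumes "2 \<le> i" "i \<le> q" "q \<le> d"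
  shows "dims (chain i q) = s (i - 1) # modes i"
  using assms(2,1)
proof (induction i rule: inc_induct)
  case base
  show ?case
  proof (cases "q = d")
    case True
    then show ?thesis by (simp add: dims_V_last)
  next
    case False
    with base assms show ?thesis
      using dims_tt_mult[of "V q" "[s (q - 1), n q]"]
      by (simp add: chain_start dims_V dims_tail_Suc modes_step del: upt_Suc)
  qed
next
  case (step i)
  then have "dims (chain (Suc i) q) = s i # modes (Suc i)" by simp
  with step assms(3) show ?case
    using dims_tt_mult[of "Z i" "[s (i - 1), n i]"]
    by (simp add: chain_step dims_Z modes_step del: upt_Suc)
qed

lemma dims_chain_Suc: "1 \<le> i \<Longrightarrow> i < q \<Longrightarrow> q \<le> d \<Longrightarrow> dims (chain (Suc i) q) = s i # modes (Suc i)"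
  by (simp add: dims_chain del: upt_Suc)

lemma dims_double:
  assumes "1 \<le> i" "i \<le> p" "p < q" "q \<le> d"
  shows "dims (double i (p, q)) = lead k i @ modes i"
  using assms(2,1)
proof (induction i rule: inc_induct)
  case base
  with assms show ?case
    using dims_tt_mult[of "U p" "lead k p @ [n p]"]
    by (simp add: double_start dims_U dims_chain_Suc modes_step del: upt_Suc)
next
  case (step i)
  then have "dims (double (Suc i) (p, q)) = k i # modes (Suc i)" by simp
  with step assms show ?case
    using dims_tt_mult[of "A i" "lead k i @ [n i]"]
    by (simp add: double_step dims_A modes_step del: upt_Suc)
qed

section \<open>Sums of partial products and their recursions\<close>

lemma finite_pairs [simp]: "finite (pairs i)"
  by (rule finite_subset[of _ "{..d} \<times> {..d}"]) (auto simp: pairs_def)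

text \<open>Splits by whether the product has \<open>U\<close> already at position \<open>i\<close>
  or still starts with \<open>A i\<close>.\<close>

lemma pairs_step: "i < d \<Longrightarrow> pairs i = Pair i ` {Suc i..d} \<union> pairs (Suc i)"
  by (auto simp: pairs_def image_iff)

definition single_sum :: "nat \<Rightarrow> tensor" where
  "single_sum i = sum_tensor (lead k i @ modes i) (single i) {i..d}"

text \<open>The explicit mode list gives the sum the right shape even at \<open>i = d\<close>, where
  there are no pairs.\<close>

definition double_sum :: "nat \<Rightarrow> tensor" where
  "double_sum i = sum_tensor (lead k i @ modes i) (double i) (pairs i)"

definition chain_sum :: "nat \<Rightarrow> tensor" where
  "chain_sum i = sum_tensor (s (i - 1) # modes i) (chain i) {i..d}"

text \<open>The terms with \<open>l > i\<close> share the left factor \<open>A i\<close>, and the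
  term \<open>l = i\<close> starts with \<open>X i\<close>.\<close>

lemma single_sum_step:
  assumes "1 \<le> i" "i < d"
  shows "single_sum i = tt_mult (A i) (single_sum (Suc i)) \<oplus>\<^sub>t tt_mult (X i) (tail (Suc i))"
proof -
  have "tt_mult (A i) (single_sum (Suc i)) =
      sum_tensor ((lead k i @ [n i]) @ modes (Suc i))
        (\<lambda>l. tt_mult (A i) (single (Suc i) l)) {Suc i..d}"
    unfolding single_sum_def lead_Suc[OF assms(1)] append_Cons append_Nil
    by (rule tt_mult_sum_right) (use assms in \<open>simp_all add: dims_A dims_single del: upt_Suc\<close>)
  also have "\<dots> = sum_tensor (lead k i @ modes i) (single i) {Suc i..d}"
    unfolding sum_tensor_def using assms by (simp add: single_step modes_step del: upt_Suc)
  also have "\<dots> \<oplus>\<^sub>t single i i = single_sum i"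
  proof (rule tensor_eqI')
    have entry: "sum_tensor (lead k i @ modes i) (single i) I \<cdot> js = (\<Sum>l\<in>I. single i l \<cdot> js)"
      if "I \<subseteq> {i..d}" for I js
      using that assms by (intro entry_sum_tensor dims_single) auto
    show "(sum_tensor (lead k i @ modes i) (single i) {Suc i..d} \<oplus>\<^sub>t single i i) \<cdot> js =
        single_sum i \<cdot> js" for js
      using assms by (simp add: single_sum_def entry_add_tensor entry dims_single
        sum.atLeast_Suc_atMost[of i d] add.commute del: upt_Suc)
  qed (simp add: single_sum_def)
  finally show ?thesis using assms by (simp add: single_start)
qed

text \<open>Chains ending later than \<open>i\<close> start with \<open>Z i\<close>; the one ending
  at \<open>i\<close> is \<open>V i\<close> followed by a tail.\<close>

lemma chain_sum_step:
  assumes "2 \<le> i" "i < d"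
  shows "chain_sum i = tt_mult (Z i) (chain_sum (Suc i)) \<oplus>\<^sub>t tt_mult (V i) (tail (Suc i))"
proof -
  have "tt_mult (Z i) (chain_sum (Suc i)) =
      sum_tensor ([s (i - 1), n i] @ modes (Suc i))
        (\<lambda>l. tt_mult (Z i) (chain (Suc i) l)) {Suc i..d}"
    unfolding chain_sum_def diff_Suc_1
    by (rule tt_mult_sum_right) (use assms in \<open>simp_all add: dims_Z dims_chain del: upt_Suc\<close>)
  also have "\<dots> = sum_tensor (s (i - 1) # modes i) (chain i) {Suc i..d}"
    unfolding sum_tensor_def using assms by (simp add: chain_step modes_step del: upt_Suc)
  also have "\<dots> \<oplus>\<^sub>t chain i i = chain_sum i"
  proof (rule tensor_eqI')
    have entry: "sum_tensor (s (i - 1) # modes i) (chain i) I \<cdot> js = (\<Sum>q\<in>I. chain i q \<cdot> js)"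
      if "I \<subseteq> {i..d}" for I js
      using that assms by (intro entry_sum_tensor dims_chain) auto
    show "(sum_tensor (s (i - 1) # modes i) (chain i) {Suc i..d} \<oplus>\<^sub>t chain i i) \<cdot> js =
        chain_sum i \<cdot> js" for js
      using assms entry by (simp add: chain_sum_def entry_add_tensor dims_chain
        sum.atLeast_Suc_atMost[of i d] add.commute del: upt_Suc)
  qed (simp add: chain_sum_def)
  finally show ?thesis using assms by (simp add: chain_start)
qed

text \<open>Pairs with first component above \<open>i\<close> share the factor \<open>A i\<close>;
  those with first component \<open>i\<close> share \<open>U i\<close>, and what remains of them is
  a chain.\<close>

lemma double_sum_step:
  assumes "1 \<le> i" "i < d"
  shows "double_sum i = tt_mult (A i) (double_sum (Suc i)) \<oplus>\<^sub>t tt_mult (U i) (chain_sum (Suc i))"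
proof -
  have "tt_mult (A i) (double_sum (Suc i)) =
      sum_tensor ((lead k i @ [n i]) @ modes (Suc i))
        (\<lambda>p. tt_mult (A i) (double (Suc i) p)) (pairs (Suc i))"
    unfolding double_sum_def lead_Suc[OF assms(1)] append_Cons append_Nil
    by (rule tt_mult_sum_right)
      (use assms in \<open>auto simp: dims_A dims_double pairs_def simp del: upt_Suc\<close>)
  also have "\<dots> = sum_tensor (lead k i @ modes i) (double i) (pairs (Suc i))"
    unfolding sum_tensor_def using assms
    by (auto simp: pairs_def double_step modes_step simp del: upt_Suc
      intro!: arg_cong[where f = "tensor _"] ext sum.cong)
  finally have A: "tt_mult (A i) (double_sum (Suc i)) =
      sum_tensor (lead k i @ modes i) (double i) (pairs (Suc i))" .
  have "tt_mult (U i) (chain_sum (Suc i)) =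
      sum_tensor ((lead k i @ [n i]) @ modes (Suc i))
        (\<lambda>q. tt_mult (U i) (chain (Suc i) q)) {Suc i..d}"
    unfolding chain_sum_def diff_Suc_1
    by (rule tt_mult_sum_right) (use assms in \<open>simp_all add: dims_U dims_chain del: upt_Suc\<close>)
  also have "\<dots> = sum_tensor (lead k i @ modes i) (\<lambda>q. double i (i, q)) {Suc i..d}"
    unfolding sum_tensor_def using assms by (simp add: double_start modes_step del: upt_Suc)
  finally have U: "tt_mult (U i) (chain_sum (Suc i)) =
      sum_tensor (lead k i @ modes i) (\<lambda>q. double i (i, q)) {Suc i..d}" .
  \<comment> \<open>The index type is left general because one of the sums below runs over single
    positions \<open>q\<close> and the others over pairs. The inclusion supplies the mode
    sizes.\<close>
  have entry: "sum_tensor (lead k i @ modes i) F I \<cdot> js = (\<Sum>x\<in>I. F x \<cdot> js)"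
    if "F ` I \<subseteq> double i ` pairs i" for F :: "'b \<Rightarrow> tensor" and I js
  proof (rule entry_sum_tensor)
    fix x assume "x \<in> I"
    with that obtain p where "F x = double i p" "p \<in> pairs i" by blast
    then show "dims (F x) = lead k i @ modes i"
      using assms by (cases p) (simp add: pairs_def dims_double del: upt_Suc)
  qed
  have "(\<Sum>p\<in>pairs i. double i p \<cdot> js) =
      (\<Sum>p\<in>pairs (Suc i). double i p \<cdot> js) + (\<Sum>q\<in>{Suc i..d}. double i (i, q) \<cdot> js)" for js
  proof -
    have "Pair i ` {Suc i..d} \<inter> pairs (Suc i) = {}" by (auto simp: pairs_def)
    then show ?thesis
      using assms by (simp add: pairs_step sum.union_disjoint sum.reindex inj_on_def add.commute)
  qed
  moreover have "double i ` pairs (Suc i) \<subseteq> double i ` pairs i"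
    "(\<lambda>q. double i (i, q)) ` {Suc i..d} \<subseteq> double i ` pairs i"
    by (auto simp: pairs_def)
  ultimately show ?thesis
    unfolding A U double_sum_def[of i]
    by (intro tensor_eqI') (simp_all add: entry_add_tensor entry del: upt_Suc)
qed

section \<open>Evaluation of the block product\<close>

definition block_core :: "nat \<Rightarrow> tensor" where
  "block_core i = block_tensor
    [[A i, U i, X i],
     [zero_tensor [s (i - 1), n i, k i], Z i, V i],
     [zero_tensor [k (i - 1), n i, k i], zero_tensor [k (i - 1), n i, s i], A i]]"

text \<open>The value of the product of the block cores from position \<open>i\<close> to
  \<open>d\<close>, as shown in \<open>tt_prod_block_cores\<close>.\<close>

definition block_col :: "nat \<Rightarrow> tensor" where
  "block_col i = block_tensor [[single_sum i \<oplus>\<^sub>t double_sum i], [chain_sum i], [tail i]]"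

lemma dims_sums [simp]:
  "dims (single_sum i) = lead k i @ modes i" "dims (double_sum i) = lead k i @ modes i"
  "dims (chain_sum i) = s (i - 1) # modes i"
  by (simp_all add: single_sum_def double_sum_def chain_sum_def del: upt_Suc)

text \<open>Merges the recursions of \<open>single_sum\<close> and \<open>double_sum\<close>. It
  serves both the first block core and the top row of every middle one.\<close>

lemma block_row_mult_col:
  assumes "1 \<le> i" "i < d"
  shows "tt_mult (block_tensor [[A i, U i, X i]]) (block_col (Suc i)) =
    single_sum i \<oplus>\<^sub>t double_sum i"
proof -
  note dA = dims_tt_mult[of "A i" "lead k i @ [n i]" "k i"]
    and dU = dims_tt_mult[of "U i" "lead k i @ [n i]" "s i"]
    and dX = dims_tt_mult[of "X i" "lead k i @ [n i]" "k i"]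
  have "tt_mult (block_tensor [[A i, U i, X i]]) (block_col (Suc i)) =
    tt_mult (A i) (single_sum (Suc i) \<oplus>\<^sub>t double_sum (Suc i)) \<oplus>\<^sub>t
      (tt_mult (U i) (chain_sum (Suc i)) \<oplus>\<^sub>t tt_mult (X i) (tail (Suc i)))"
    unfolding block_col_def
    by (rule tt_mult_block_row_column[where ps = "lead k i @ [n i]"])
      (use assms in \<open>simp_all add: dims_A dims_U dims_X dims_tail del: upt_Suc\<close>)
  also have "tt_mult (A i) (single_sum (Suc i) \<oplus>\<^sub>t double_sum (Suc i)) =
      tt_mult (A i) (single_sum (Suc i)) \<oplus>\<^sub>t tt_mult (A i) (double_sum (Suc i))"
    by (rule tt_mult_add_right[where ps = "lead k i @ [n i]"])
      (use assms in \<open>simp_all add: dims_A del: upt_Suc\<close>)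
  \<comment> \<open>Both sides consist of the same four products in different grouping, so they
    agree entrywise.\<close>
  finally show ?thesis
    unfolding single_sum_step[OF assms] double_sum_step[OF assms]
    using assms by (auto intro!: tensor_eqI'
      simp: entry_add_tensor dA dU dX dims_A dims_U dims_X dims_tail simp del: upt_Suc)
qed

text \<open>The rows are evaluated separately: the top row by \<open>block_row_mult_col\<close>, the
  other two by the recursions of \<open>chain_sum\<close> and \<open>tail\<close>, as the zero
  blocks contribute nothing.\<close>

lemma block_core_mult_col:
  assumes "2 \<le> i" "i < d"
  shows "tt_mult (block_core i) (block_col (Suc i)) = block_col i"
proof -
  have sums: "dims (single_sum (Suc i) \<oplus>\<^sub>t double_sum (Suc i)) = k i # modes (Suc i)"
    "dims (chain_sum (Suc i)) = s i # modes (Suc i)"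
    "dims (tail (Suc i)) = k i # modes (Suc i)"
    using assms by (simp_all add: dims_tail del: upt_Suc)
  have lead: "lead k i = [k (i - 1)]" using assms by (simp add: lead_def)
  note cores = dims_A[of i] dims_U[of i] dims_X[of i] dims_Z[of i] dims_V[of i] lead
  have zero: "tt_mult (zero_tensor [a, n i, b]) B = zero_tensor (a # modes i)"
    if "dims B = b # modes (Suc i)" for a b B
    using tt_mult_zero_left[OF that, of "[a, n i]"] assms by (simp add: modes_step del: upt_Suc)
  have dims: "dims (tt_mult G B) = a # modes i"
    if "dims G = [a, n i, b]" "dims B = b # modes (Suc i)" for G B a b
    using dims_tt_mult[of G "[a, n i]" b B] that assms by (simp add: modes_step del: upt_Suc)
  have row2: "tt_mult (block_tensor [[zero_tensor [s (i - 1), n i, k i], Z i, V i]])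
      (block_col (Suc i)) = chain_sum i"
  proof -
    have "tt_mult (block_tensor [[zero_tensor [s (i - 1), n i, k i], Z i, V i]])
        (block_col (Suc i)) =
      tt_mult (zero_tensor [s (i - 1), n i, k i]) (single_sum (Suc i) \<oplus>\<^sub>t double_sum (Suc i)) \<oplus>\<^sub>t
        (tt_mult (Z i) (chain_sum (Suc i)) \<oplus>\<^sub>t tt_mult (V i) (tail (Suc i)))"
      unfolding block_col_def
      by (rule tt_mult_block_row_column[where ps = "[s (i - 1), n i]"])
        (use assms sums cores in \<open>simp_all del: upt_Suc\<close>)
    also have "\<dots> = chain_sum i"
      unfolding zero[OF sums(1)] chain_sum_step[OF assms]
      using assms cores sums dims by (intro tensor_eqI') (simp_all add: entry_add_tensor del: upt_Suc)
    finally show ?thesis .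
  qed
  have row3: "tt_mult (block_tensor [[zero_tensor [k (i - 1), n i, k i],
      zero_tensor [k (i - 1), n i, s i], A i]]) (block_col (Suc i)) = tail i"
  proof -
    have "tt_mult (block_tensor [[zero_tensor [k (i - 1), n i, k i],
        zero_tensor [k (i - 1), n i, s i], A i]]) (block_col (Suc i)) =
      tt_mult (zero_tensor [k (i - 1), n i, k i]) (single_sum (Suc i) \<oplus>\<^sub>t double_sum (Suc i)) \<oplus>\<^sub>t
        (tt_mult (zero_tensor [k (i - 1), n i, s i]) (chain_sum (Suc i)) \<oplus>\<^sub>t
          tt_mult (A i) (tail (Suc i)))"
      unfolding block_col_def
      by (rule tt_mult_block_row_column[where ps = "[k (i - 1), n i]"])
        (use assms sums cores in \<open>simp_all del: upt_Suc\<close>)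
    also have "\<dots> = tail i"
      unfolding zero[OF sums(1)] zero[OF sums(2)] tail_step[OF assms(2)]
      using assms cores sums dims by (intro tensor_eqI') (simp_all add: entry_add_tensor del: upt_Suc)
    finally show ?thesis .
  qed
  have "dims (block_col (Suc i)) = (k i + (s i + k i)) # modes (Suc i)"
    unfolding block_col_def block_column using sums by (intro dims_append_first) simp_all
  then have "tt_mult (block_core i) (block_col (Suc i)) = block_tensor
      [[tt_mult (block_tensor [[A i, U i, X i]]) (block_col (Suc i))],
       [tt_mult (block_tensor [[zero_tensor [s (i - 1), n i, k i], Z i, V i]]) (block_col (Suc i))],
       [tt_mult (block_tensor [[zero_tensor [k (i - 1), n i, k i],
          zero_tensor [k (i - 1), n i, s i], A i]]) (block_col (Suc i))]]"
    unfolding block_core_def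
    by (intro tt_mult_block_rows[where ps = "[n i]"]) (use assms cores in \<open>simp_all del: upt_Suc\<close>)
  also have "tt_mult (block_tensor [[A i, U i, X i]]) (block_col (Suc i)) =
      single_sum i \<oplus>\<^sub>t double_sum i"
    using assms by (intro block_row_mult_col) simp_all
  finally show ?thesis unfolding row2 row3 by (simp add: block_col_def)
qed

text \<open>Start of the recursion: at \<open>d\<close> each sum has at most one term, and no pair
  fits.\<close>

lemma block_col_last: "block_col d = block_tensor [[X d], [V d], [A d]]"
proof -
  have lead: "lead k d = [k (d - 1)]" using d_ge_2 by (simp add: lead_def)
  have "single_sum d \<oplus>\<^sub>t double_sum d = X d"
  proof (rule tensor_eqI')
    have "pairs d = {}" by (auto simp: pairs_def)
    then have "double_sum d \<cdot> js = 0" for js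
      by (simp add: double_sum_def sum_tensor_def entry_tensor)
    moreover have "single_sum d \<cdot> js = X d \<cdot> js" for js
      unfolding single_sum_def by (subst entry_sum_tensor) (simp_all add: dims_X_last lead)
    ultimately show "(single_sum d \<oplus>\<^sub>t double_sum d) \<cdot> js = X d \<cdot> js" for js
      by (simp add: entry_add_tensor)
  qed (simp add: dims_X_last lead)
  moreover have "chain_sum d = V d"
  proof (rule tensor_eqI')
    show "chain_sum d \<cdot> js = V d \<cdot> js" for js
      unfolding chain_sum_def by (subst entry_sum_tensor) (simp_all add: dims_V_last)
  qed (simp add: dims_V_last)
  ultimately show ?thesis by (simp add: block_col_def)
qed

lemma tt_prod_block_cores:
  assumes "2 \<le> i" "i \<le> d"
  shows "tt_prod (map block_core [i..<d] @ [block_col d]) = block_col i"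
  using assms(2,1)
proof (induction i rule: inc_induct)
  case base
  then show ?case by simp
next
  case (step i)
  then show ?case by (simp add: upt_conv_Cons tt_prod_Cons block_core_mult_col)
qed

text \<open>The first block row meets \<open>block_col 2\<close>. For \<open>d = 2\<close> there are
  no middle cores and this is the last block column itself.\<close>

lemma tt_prod_blocks:
  "tt_prod ([block_tensor [[A 1, U 1, X 1]]] @ map block_core [2..<d] @
      [block_tensor [[X d], [V d], [A d]]]) = single_sum 1 \<oplus>\<^sub>t double_sum 1"
  using d_ge_2 block_row_mult_col[of 1] tt_prod_block_cores[of 2]
  by (simp add: tt_prod_Cons numeral_2_eq_2 flip: block_col_last)

end

section \<open>Orthogonality of the summands\<close>

text \<open>\<open>chain_orth_tail\<close> is the hypothesis on \<open>V i\<close>, since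
  \<open>chain i i\<close> is \<open>V i\<close> followed by the cores \<open>A\<close> after
  position \<open>i\<close>; this includes \<open>i = d\<close>.\<close>

locale orthogonal_tt_cores = tt_cores +
  assumes A_orthonormal: "1 \<le> i \<Longrightarrow> i < d \<Longrightarrow> m < k i \<Longrightarrow> l < k i \<Longrightarrow>
      gram_R (A i) (A i) m l = (if m = l then 1 else 0)"
    and A_orth_U: "1 \<le> i \<Longrightarrow> i < d \<Longrightarrow> orth_R (A i) (U i)"
    and A_orth_X: "1 \<le> i \<Longrightarrow> i < d \<Longrightarrow> orth_R (A i) (X i)"
    and chain_orth_tail: "2 \<le> i \<Longrightarrow> i \<le> d \<Longrightarrow> orth_L (chain i i) (tail i)"
begin

text \<open>Removes the orthonormal factors \<open>A i\<close> common to two families of truncated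
  products. The shape is prescribed only for \<open>i > 1\<close>, where a product occurs as a right
  factor; at \<open>i = 1\<close> there is no leading rank mode.\<close>

lemma peel_left_orthonormal:
  assumes "p < d"
    and "\<And>i. 1 \<le> i \<Longrightarrow> i < p \<Longrightarrow> F i = tt_mult (A i) (F (Suc i)) \<and> G i = tt_mult (A i) (G (Suc i))"
    and "\<And>i. 1 < i \<Longrightarrow> i \<le> p \<Longrightarrow> dims (F i) = k (i - 1) # modes i \<and> dims (G i) = k (i - 1) # modes i"
    and "1 \<le> i" "i \<le> p"
  shows "inner_tensor (F i) (G i) = inner_tensor (F p) (G p)"
  using assms(5,4)
proof (induction i rule: inc_induct)
  case base
  then show ?case by simp
next
  case (step i)
  have "inner_tensor (F i) (G i) = inner_tensor (F (Suc i)) (G (Suc i))"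
    using step assms(2)[of i] assms(3)[of "Suc i"] assms(1)
      inner_tt_mult_orthonormal[of "A i" "lead k i @ [n i]" "k i" "F (Suc i)" "modes (Suc i)" "G (Suc i)"]
    by (simp add: dims_A A_orthonormal del: upt_Suc)
  with step show ?case by simp
qed

text \<open>At \<open>i = q\<close> this is the hypothesis on \<open>V q\<close>; moving left
  prepends \<open>A i\<close> to the tail and \<open>Z i\<close> to the chain, which preserves
  \<open>orth_L\<close>.\<close>

lemma tail_orth_chain:
  assumes "2 \<le> i" "i \<le> q" "q \<le> d"
  shows "orth_L (tail i) (chain i q)"
  using assms(2,1)
proof (induction i rule: inc_induct)
  case base
  with assms show ?case
    by (intro orth_L_commute[OF dims_chain _ chain_orth_tail]) (auto simp: dims_tail lead_def simp del: upt_Suc)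
next
  case (step i)
  with assms(3) show ?case
    using orth_L_tt_mult[of "A i" "k (i - 1)" "[n i]" "k i" "tail (Suc i)" "modes (Suc i)" "Z i" "s (i - 1)" "s i"]
    by (simp add: tail_step chain_step dims_A dims_Z dims_tail_Suc dims_chain_Suc lead_def del: upt_Suc)
qed

text \<open>At \<open>q\<close> the shorter chain continues as \<open>V q\<close> times a tail and
  the longer one as \<open>Z q\<close> times a chain, so \<open>tail_orth_chain\<close> applies to
  the right factors. Further left both chains gain the same \<open>Z i\<close>.\<close>

lemma chain_orth_chain:
  assumes "2 \<le> i" "i \<le> q" "q < r" "r \<le> d"
  shows "orth_L (chain i q) (chain i r)"
  using assms(2,1)
proof (induction i rule: inc_induct)
  case base
  with assms show ?case
    using orth_L_tt_mult[of "V q" "s (q - 1)" "[n q]" "k q" "tail (Suc q)" "modes (Suc q)" "Z q" "s (q - 1)" "s q"]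
    by (simp add: chain_start chain_step dims_V dims_Z dims_tail_Suc dims_chain_Suc tail_orth_chain del: upt_Suc)
next
  case (step i)
  with assms show ?case
    using orth_L_tt_mult[of "Z i" "s (i - 1)" "[n i]" "s i" "chain (Suc i) q" "modes (Suc i)" "Z i" "s (i - 1)" "s i"]
    by (simp add: chain_step[of i] dims_Z dims_chain_Suc del: upt_Suc)
qed

lemma inner_single_single:
  assumes "1 \<le> i" "i < j" "j \<le> d"
  shows "inner_tensor (single 1 i) (single 1 j) = 0"
proof -
  have "inner_tensor (single 1 i) (single 1 j) = inner_tensor (single i i) (single i j)"
    by (rule peel_left_orthonormal[where F = "\<lambda>m. single m i" and G = "\<lambda>m. single m j"])
      (use assms in \<open>auto simp: dims_single lead_def simp del: upt_Suc intro: single_step\<close>)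
  \<comment> \<open>The leading cores are now \<open>X i\<close> and \<open>A i\<close>, whose right
    Gram matrix vanishes.\<close>
  also have "\<dots> = 0"
    using assms orth_R_commute[OF _ _ A_orth_X, of i "lead k i @ [n i]" "k i" "k i"]
      inner_tt_mult_orth[of "X i" "lead k i @ [n i]" "k i" "tail (Suc i)" "modes (Suc i)" "A i" "k i"
        "single (Suc i) j"]
    by (simp add: single_start single_step dims_A dims_X dims_tail_Suc dims_single del: upt_Suc)
  finally show ?thesis .
qed

lemma inner_single_double:
  assumes "1 \<le> i" "i \<le> d" "1 \<le> p" "p < q" "q \<le> d"
  shows "inner_tensor (single 1 i) (double 1 (p, q)) = 0"
proof -
  \<comment> \<open>The first position where the two products can have different cores; it is below
    \<open>d\<close> because \<open>p < q\<close> and \<open>q \<le> d\<close>.\<close>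
  define m where "m = min i p"
  have "inner_tensor (single 1 i) (double 1 (p, q)) = inner_tensor (single m i) (double m (p, q))"
    by (rule peel_left_orthonormal[where F = "\<lambda>m. single m i" and G = "\<lambda>m. double m (p, q)"])
      (use assms in \<open>auto simp: m_def dims_single dims_double lead_def simp del: upt_Suc
        intro: single_step double_step\<close>)
  also have "\<dots> = 0"
  proof (cases i p rule: linorder_cases)
    \<comment> \<open>Here \<open>X i\<close> meets \<open>A i\<close>.\<close>
    case less
    then show ?thesis
      using assms orth_R_commute[OF _ _ A_orth_X, of i "lead k i @ [n i]" "k i" "k i"]
        inner_tt_mult_orth[of "X i" "lead k i @ [n i]" "k i" "tail (Suc i)" "modes (Suc i)" "A i" "k i"
          "double (Suc i) (p, q)"]
      by (simp add: m_def single_start double_step dims_A dims_X dims_tail_Suc dims_double del: upt_Suc)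
  next
    \<comment> \<open>Here \<open>X i\<close> meets \<open>U i\<close>, a pair with no orthogonality
      relation, so the vanishing comes from the right factors, a tail and a chain.\<close>
    case equal
    then show ?thesis
      using assms tail_orth_chain[of "Suc i" q]
        inner_tt_mult_orth[of "X i" "lead k i @ [n i]" "k i" "tail (Suc i)" "modes (Suc i)" "U i" "s i"
          "chain (Suc i) q"]
      by (simp add: m_def single_start double_start dims_U dims_X dims_tail_Suc dims_chain_Suc del: upt_Suc)
  next
    \<comment> \<open>Here \<open>A p\<close> meets \<open>U p\<close>.\<close>
    case greater
    then show ?thesis
      using assms A_orth_U[of p]
        inner_tt_mult_orth[of "A p" "lead k p @ [n p]" "k p" "single (Suc p) i" "modes (Suc p)" "U p" "s p"
          "chain (Suc p) q"]
      by (simp add: m_def single_step double_start dims_A dims_U dims_single dims_chain_Suc del: upt_Suc)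
  qed
  finally show ?thesis .
qed

lemma inner_double_double_first_less:
  assumes "1 \<le> p" "p < q" "q \<le> d" "p < p'" "p' < q'" "q' \<le> d"
  shows "inner_tensor (double 1 (p, q)) (double 1 (p', q')) = 0"
proof -
  have "inner_tensor (double 1 (p, q)) (double 1 (p', q')) =
      inner_tensor (double p (p, q)) (double p (p', q'))"
    by (rule peel_left_orthonormal[where F = "\<lambda>m. double m (p, q)" and G = "\<lambda>m. double m (p', q')"])
      (use assms in \<open>auto simp: dims_double lead_def simp del: upt_Suc intro: double_step\<close>)
  \<comment> \<open>At position \<open>p\<close> the first product has \<open>U p\<close>, while the
    second still has \<open>A p\<close>.\<close>
  also have "\<dots> = 0"
    using assms orth_R_commute[OF _ _ A_orth_U, of p "lead k p @ [n p]" "k p" "s p"]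
      inner_tt_mult_orth[of "U p" "lead k p @ [n p]" "s p" "chain (Suc p) q" "modes (Suc p)" "A p" "k p"
        "double (Suc p) (p', q')"]
    by (simp add: double_start double_step dims_A dims_U dims_chain_Suc dims_double del: upt_Suc)
  finally show ?thesis .
qed

lemma inner_double_double_first_eq:
  assumes "1 \<le> p" "p < q" "q < r" "r \<le> d"
  shows "inner_tensor (double 1 (p, q)) (double 1 (p, r)) = 0"
proof -
  have "inner_tensor (double 1 (p, q)) (double 1 (p, r)) =
      inner_tensor (double p (p, q)) (double p (p, r))"
    by (rule peel_left_orthonormal[where F = "\<lambda>m. double m (p, q)" and G = "\<lambda>m. double m (p, r)"])
      (use assms in \<open>auto simp: dims_double lead_def simp del: upt_Suc intro: double_step\<close>)
  \<comment> \<open>Both products start with \<open>U p\<close>, which need not be orthonormal; the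
    chains of different length to its right are orthogonal.\<close>
  also have "\<dots> = 0"
    using assms chain_orth_chain[of "Suc p" q r]
      inner_tt_mult_orth[of "U p" "lead k p @ [n p]" "s p" "chain (Suc p) q" "modes (Suc p)" "U p" "s p"
        "chain (Suc p) r"]
    by (simp add: double_start dims_U dims_chain_Suc del: upt_Suc)
  finally show ?thesis .
qed

lemma inner_single_single_neq:
  assumes "i \<in> {1..d}" "j \<in> {1..d}" "i \<noteq> j"
  shows "inner_tensor (single 1 i) (single 1 j) = 0"
proof (cases "i < j")
  case True
  with assms show ?thesis using inner_single_single[of i j] by simp
next
  case False
  with assms have "inner_tensor (single 1 j) (single 1 i) = 0"
    using inner_single_single[of j i] by simp
  with assms show ?thesis
    by (subst inner_tensor_commute) (auto simp: dims_single simp del: upt_Suc)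
qed

lemma inner_double_double_neq:
  assumes "x \<in> pairs 1" "y \<in> pairs 1" "x \<noteq> y"
  shows "inner_tensor (double 1 x) (double 1 y) = 0"
proof -
  \<comment> \<open>Distinct pairs are comparable lexicographically, so symmetry of the inner
    product reduces everything to this case.\<close>
  have less: "inner_tensor (double 1 x) (double 1 y) = 0"
    if "x \<in> pairs 1" "y \<in> pairs 1" "fst x < fst y \<or> fst x = fst y \<and> snd x < snd y" for x y
    using that inner_double_double_first_less inner_double_double_first_eq
    by (auto simp: pairs_def)
  have "dims (double 1 x) = dims (double 1 y)"
    using assms by (auto simp: pairs_def dims_double simp del: upt_Suc)
  then have "inner_tensor (double 1 x) (double 1 y) = inner_tensor (double 1 y) (double 1 x)"
    by (rule inner_tensor_commute)
  moreover have "(fst x < fst y \<or> fst x = fst y \<and> snd x < snd y) \<or>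
      (fst y < fst x \<or> fst y = fst x \<and> snd y < snd x)"
    using assms(3) by (metis nat_neq_iff prod_eqI)
  ultimately show ?thesis
    using less[OF assms(1,2)] less[OF assms(2,1)] by (elim disjE[of "_ \<or> _" "_ \<or> _"]) simp_all
qed

end

section \<open>The block product formula with orthogonal summands\<close>

theorem mainTheorem3:
  fixes d :: nat and n k s :: "nat \<Rightarrow> nat"
    and T :: tensor and A U X Z V :: "nat \<Rightarrow> tensor"
  assumes d: "d \<ge> 2"
    and n_pos: "\<And>i. i \<in> {1..d} \<Longrightarrow> n i > 0"
    and T: "T \<in> TT_rank_manifold (map n [1..<Suc d]) k"
    and A_first: "A 1 \<in> carrier_tensor [n 1, k 1]"
    and A_mid: "\<And>i. i \<in> {2..d - 1} \<Longrightarrow> A i \<in> carrier_tensor [k (i - 1), n i, k i]"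
    and A_last: "A d \<in> carrier_tensor [k (d - 1), n d]"
    and A_prod: "tt_prod (map A [1..<Suc d]) = T"
    and A_orth: "\<And>i. i \<in> {1..d - 1} \<Longrightarrow>
          transpose_mat (mat_R (A i)) * mat_R (A i) = 1\<^sub>m (k i)"
    and U_first: "U 1 \<in> carrier_tensor [n 1, s 1]"
    and X_first: "X 1 \<in> carrier_tensor [n 1, k 1]"
    and U_mid: "\<And>i. i \<in> {2..d - 1} \<Longrightarrow> U i \<in> carrier_tensor [k (i - 1), n i, s i]"
    and X_mid: "\<And>i. i \<in> {2..d - 1} \<Longrightarrow> X i \<in> carrier_tensor [k (i - 1), n i, k i]"
    and Z_mid: "\<And>i. i \<in> {2..d - 1} \<Longrightarrow> Z i \<in> carrier_tensor [s (i - 1), n i, s i]"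
    and V_mid: "\<And>i. i \<in> {2..d - 1} \<Longrightarrow> V i \<in> carrier_tensor [s (i - 1), n i, k i]"
    and X_last: "X d \<in> carrier_tensor [k (d - 1), n d]"
    and V_last: "V d \<in> carrier_tensor [s (d - 1), n d]"
    and AU: "\<And>i. i \<in> {1..d - 1} \<Longrightarrow>
          transpose_mat (mat_R (A i)) * mat_R (U i) = 0\<^sub>m (k i) (s i)"
    and AX: "\<And>i. i \<in> {1..d - 1} \<Longrightarrow>
          transpose_mat (mat_R (A i)) * mat_R (X i) = 0\<^sub>m (k i) (k i)"
    and VA: "\<And>i. i \<in> {2..d} \<Longrightarrow>
          mat_L (tt_prod (V i # map A [Suc i..<Suc d])) *
          transpose_mat (mat_L (tt_prod (map A [i..<Suc d]))) = 0\<^sub>m (s (i - 1)) (k (i - 1))"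
  shows "let ns = map n [1..<Suc d];
      single = (\<lambda>i. tt_prod (map A [1..<i] @ [X i] @ map A [Suc i..<Suc d]));
      double = (\<lambda>(i, j). tt_prod
        (map A [1..<i] @ [U i] @ map Z [Suc i..<j] @ [V j] @ map A [Suc j..<Suc d]));
      pairs = {(i, j). 1 \<le> i \<and> i < j \<and> j \<le> d}
    in
      tt_prod
        ([block_tensor [[A 1, U 1, X 1]]] @
         map (\<lambda>i. block_tensor
           [[A i, U i, X i],
            [zero_tensor [s (i - 1), n i, k i], Z i, V i],
            [zero_tensor [k (i - 1), n i, k i], zero_tensor [k (i - 1), n i, s i], A i]])
           [2..<d] @
         [block_tensor [[X d], [V d], [A d]]])
      = sum_tensor ns single {1..d} \<oplus>\<^sub>t sum_tensor ns double pairs \<and>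
      (\<forall>i\<in>{1..d}. \<forall>i'\<in>{1..d}. i \<noteq> i' \<longrightarrow> inner_tensor (single i) (single i') = 0) \<and>
      (\<forall>i\<in>{1..d}. \<forall>p\<in>pairs. inner_tensor (single i) (double p) = 0) \<and>
      (\<forall>p\<in>pairs. \<forall>q\<in>pairs. p \<noteq> q \<longrightarrow> inner_tensor (double p) (double q) = 0)"
proof -
  interpret tt_cores d n k s A U X Z V
    by unfold_locales
      (use d A_first A_mid A_last U_first U_mid X_first X_mid X_last Z_mid V_mid V_last in
        \<open>auto simp: carrier_tensor_def lead_def\<close>)
  \<comment> \<open>Reads a vanishing matrix product entrywise; applied to \<open>U i\<close> with
    \<open>c = s i\<close> and to \<open>X i\<close> with \<open>c = k i\<close>.\<close>
  have orth_R: "orth_R (A i) G"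
    if "1 \<le> i" "i < d" "dims G = lead k i @ [n i, c]"
      "transpose_mat (mat_R (A i)) * mat_R G = 0\<^sub>m (k i) c" for i G c
    using that transpose_mat_R_mult_entry[of "A i" "lead k i @ [n i]" "k i" G c]
    by (simp add: orth_R_def dims_A)
  interpret orthogonal_tt_cores d n k s A U X Z V
  proof unfold_locales
    fix i m l assume i: "1 \<le> i" "i < d" "m < k i" "l < k i"
    then show "gram_R (A i) (A i) m l = (if m = l then 1 else 0)"
      using A_orth[of i] dims_A[of i]
        transpose_mat_R_mult_entry[of "A i" "lead k i @ [n i]" "k i" "A i" "k i" m l]
      by simp
  next
    fix i assume "1 \<le> i" "i < d"
    then show "orth_R (A i) (U i)" "orth_R (A i) (X i)"
      using AU[of i] AX[of i] orth_R dims_U dims_X by simp_all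
  next
    fix i assume i: "2 \<le> i" "i \<le> d"
    \<comment> \<open>The list of \<open>Z\<close> cores in \<open>chain i i\<close> is empty, which
      identifies it with the product in the hypothesis on \<open>V i\<close>.\<close>
    have "tt_prod (V i # map A [Suc i..<Suc d]) = chain i i" by (simp add: chain_def)
    moreover have "tt_prod (map A [i..<Suc d]) = tail i" by (simp add: tail_def)
    ultimately have "mat_L (chain i i) * transpose_mat (mat_L (tail i)) = 0\<^sub>m (s (i - 1)) (k (i - 1))"
      using VA[of i] i by simp
    moreover have "dims (chain i i) = s (i - 1) # modes i" "dims (tail i) = k (i - 1) # modes i"
      using i by (simp_all add: dims_chain dims_tail lead_def del: upt_Suc)
    ultimately show "orth_L (chain i i) (tail i)"
      using mat_L_mult_transpose_entry[of "chain i i" "s (i - 1)" "modes i" "tail i" "k (i - 1)"]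
      by (simp add: orth_L_def del: upt_Suc)
  qed
  have single: "(\<lambda>i. tt_prod (map A [1..<i] @ [X i] @ map A [Suc i..<Suc d])) = single 1"
    by (simp add: single_def fun_eq_iff)
  have double: "(\<lambda>(i, j). tt_prod (map A [1..<i] @ [U i] @ map Z [Suc i..<j] @ [V j] @
      map A [Suc j..<Suc d])) = double 1"
    by (simp add: double_def)
  \<comment> \<open>At \<open>i = 1\<close> the prefix \<open>lead k 1\<close> is empty, so the mode
    list is exactly that of the full tensor.\<close>
  have sums: "sum_tensor (modes 1) (single 1) {1..d} = single_sum 1"
    "sum_tensor (modes 1) (double 1) (pairs 1) = double_sum 1"
    by (simp_all add: single_sum_def double_sum_def lead_def)
  have pairs: "{(i, j). 1 \<le> i \<and> i < j \<and> j \<le> d} = pairs 1"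
    by (simp add: pairs_def)
  show ?thesis
    unfolding Let_def single double pairs sums
  proof (intro conjI ballI impI)
    fix i p assume "i \<in> {1..d}" "p \<in> pairs 1"
    then show "inner_tensor (single 1 i) (double 1 p) = 0"
      by (cases p) (simp add: pairs_def inner_single_double[unfolded One_nat_def])
  qed (rule tt_prod_blocks[unfolded block_core_def] inner_single_single_neq
    inner_double_double_neq; assumption)+
qed

end
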